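(* For every integer $m\ge1$ the maps $S^{2m}:\mathbf W^m\to\mathbf W^{-m}$ and $S^{-2m}:\mathbf W^{-m}\to\mathbf W^m$ are mutually inverse, and for $\mathbf u\in\mathbf W^m$ and $\mathbf v=S^{2m}\mathbf u$ one has $$\{\mathbf u,\mathbf u\}_m=(S^m\mathbf u,S^m\mathbf u)=(S^{-m}\mathbf v,S^{-m}\mathbf v)=\{\mathbf v,\mathbf v\}_{-m}.$$
   Context: $G\subset\mathbb R^3$ is a bounded connected domain with smooth boundary $\Gamma$, $\mathbf n$ is the unit normal on $\Gamma$, $\gamma$ denotes the trace on $\Gamma$; $\mathbf L_2(G)$ is the real Hilbert space of square integrable vector fields with inner product $(\mathbf u,\mathbf v)=\int_G\mathbf u\cdot\mathbf v\,d\mathbf x$. $\mathcal B$ is the orthogonal complement of $\{\nabla h:h\in H^1(G)\}$ in $\mathbf L_2(G)$; $\mathcal B_H=\{\mathbf u\in\mathbf L_2(G):\mathrm{div}\,\mathbf u=0,\ \mathrm{rot}\,\mathbf u=0\text{ in }G,\ \gamma(\mathbf n\cdot\mathbf u)=0\}$; $\mathbf V^0$ is the orthogonal complement of $\mathcal B_H$ in $\mathcal B$. $S$ is the self-adjoint operator in $\mathbf V^0$ with domain $\mathbf W^1=\{\mathbf f\in\mathbf V^0:\mathrm{rot}\,\mathbf f\in\mathbf V^0\}$, $S\mathbf f=\mathrm{rot}\,\mathbf f$. Standing convention: the eigenvalues of $S$ come in pairs $\pm\lambda_j$, $0<\lambda_1\le\lambda_2\le\dots$, and $\{\mathbf q_j^+,\mathbf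 q_j^-\}_{j\ge1}$ is an orthonormal basis of $\mathbf V^0$ with $\mathbf q_j^\pm\in\mathbf C^\infty(\overline G)$, $\mathrm{rot}\,\mathbf q_j^\pm=\pm\lambda_j\mathbf q_j^\pm$, $\gamma(\mathbf n\cdot\mathbf q_j^\pm)=0$. For $m\ge1$, $\mathbf W^m=\{\mathbf f\in\mathbf V^0,\ \mathrm{rot}\,\mathbf f\in\mathbf V^0,\dots,\mathrm{rot}^m\mathbf f\in\mathbf V^0\}$ with inner product $\{\mathbf u,\mathbf w\}_m=(S^m\mathbf u,S^m\mathbf w)$. $\mathbf W^{-m}$ is the space of functionals $\mathbf v$ given by real coefficients $(\mathbf v,\mathbf q_j^\pm)$ (and vanishing on $\mathcal B_H$) with $\sum_j\lambda_j^{-2m}[(\mathbf v,\mathbf q_j^+)^2+(\mathbf v,\mathbf q_j^-)^2]<\infty$, with inner product $\{\mathbf u,\mathbf w\}_{-m}=(S^{-m}\mathbf u,S^{-m}\mathbf w)$. For every integer $p$, $S^p$ multiplies the coefficient at $\mathbf q_j^\pm$ by $(\pm\lambda_j)^p$. *)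

theory Defs
  imports "HOL-Analysis.Analysis"
begin

section \<open>Smooth functions, classical differential operators\<close>

type_synonym field = "real^3 \<Rightarrow> real^3"

text \<open>The predicate below is meant for open \<open>U\<close>.\<close>

primrec Ck_on :: "nat \<Rightarrow> 'a::real_normed_vector set \<Rightarrow> ('a \<Rightarrow> 'b::real_normed_vector) \<Rightarrow> bool" where
  "Ck_on 0 U f \<longleftrightarrow> continuous_on U f"
| "Ck_on (Suc k) U f \<longleftrightarrow>
     f differentiable_on U \<and> (\<forall>d. Ck_on k U (\<lambda>x. frechet_derivative f (at x) d))"

definition smooth_on :: "'a::real_normed_vector set \<Rightarrow> ('a \<Rightarrow> 'b::real_normed_vector) \<Rightarrow> bool" where
  "smooth_on U f \<longleftrightarrow> (\<forall>k. Ck_on k U f)"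

definition partial :: "3 \<Rightarrow> (real^3 \<Rightarrow> real) \<Rightarrow> real^3 \<Rightarrow> real" where
  "partial i f x = frechet_derivative f (at x) (axis i 1)"

definition grad :: "(real^3 \<Rightarrow> real) \<Rightarrow> field" where
  "grad f x = (\<chi> i. partial i f x)"

definition dive :: "field \<Rightarrow> real^3 \<Rightarrow> real" where
  "dive u x = (\<Sum>i\<in>UNIV. partial i (\<lambda>y. u y $ i) x)"

definition rot :: "field \<Rightarrow> field" where
  "rot u x = vector
     [partial 2 (\<lambda>y. u y $ 3) x - partial 3 (\<lambda>y. u y $ 2) x,
      partial 3 (\<lambda>y. u y $ 1) x - partial 1 (\<lambda>y. u y $ 3) x,
      partial 1 (\<lambda>y. u y $ 2) x - partial 2 (\<lambda>y. u y $ 1) x]"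

section \<open>Domains with smooth boundary\<close>

definition local_defining_function ::
    "(real^3) set \<Rightarrow> real^3 \<Rightarrow> (real^3) set \<Rightarrow> (real^3 \<Rightarrow> real) \<Rightarrow> bool" where
  "local_defining_function G p U \<rho> \<longleftrightarrow>
     open U \<and> p \<in> U \<and> smooth_on U \<rho> \<and> (\<forall>x\<in>U. grad \<rho> x \<noteq> 0) \<and> G \<inter> U = {x\<in>U. \<rho> x < 0}"

definition smooth_bounded_domain :: "(real^3) set \<Rightarrow> bool" where
  "smooth_bounded_domain G \<longleftrightarrow>
     open G \<and> connected G \<and> bounded G \<and> G \<noteq> {} \<and>
     (\<forall>p\<in>frontier G. \<exists>U \<rho>. local_defining_function G p U \<rho>)"

definition is_unit_normal :: "(real^3) set \<Rightarrow> real^3 \<Rightarrow> real^3 \<Rightarrow> bool" where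
  "is_unit_normal G p n \<longleftrightarrow>
     (\<exists>U \<rho>. local_defining_function G p U \<rho> \<and> n = grad \<rho> p /\<^sub>R norm (grad \<rho> p))"

definition smooth_upto_boundary :: "(real^3) set \<Rightarrow> field \<Rightarrow> bool" where
  "smooth_upto_boundary G u \<longleftrightarrow> (\<exists>w. smooth_on UNIV w \<and> (\<forall>x\<in>closure G. u x = w x))"

definition normal_component_zero :: "(real^3) set \<Rightarrow> field \<Rightarrow> bool" where
  "normal_component_zero G u \<longleftrightarrow> (\<forall>p\<in>frontier G. \<forall>n. is_unit_normal G p n \<longrightarrow> n \<bullet> u p = 0)"

section \<open>Square integrable fields and weak derivatives\<close>

text \<open>Elements of the Hilbert space are represented by square integrable functions; equality in
  the Hilbert space is \<open>eq_ae\<close>. All sets of fields below are saturated for this relation.\<close>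

definition L2 :: "(real^3) set \<Rightarrow> (real^3 \<Rightarrow> 'b::euclidean_space) set" where
  "L2 G = {u. u \<in> borel_measurable (lebesgue_on G) \<and>
              integrable (lebesgue_on G) (\<lambda>x. (norm (u x))\<^sup>2)}"

definition ip :: "(real^3) set \<Rightarrow> (real^3 \<Rightarrow> 'b::euclidean_space) \<Rightarrow> (real^3 \<Rightarrow> 'b) \<Rightarrow> real" where
  "ip G u v = (LINT x|lebesgue_on G. u x \<bullet> v x)"

definition eq_ae :: "(real^3) set \<Rightarrow> (real^3 \<Rightarrow> 'b) \<Rightarrow> (real^3 \<Rightarrow> 'b) \<Rightarrow> bool" where
  "eq_ae G u v \<longleftrightarrow> (AE x in lebesgue_on G. u x = v x)"

definition test :: "(real^3) set \<Rightarrow> (real^3 \<Rightarrow> 'b::euclidean_space) set" where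
  "test G = {\<phi>. smooth_on UNIV \<phi> \<and> (\<exists>K. compact K \<and> K \<subseteq> G \<and> (\<forall>x. x \<notin> K \<longrightarrow> \<phi> x = 0))}"

definition has_grad :: "(real^3) set \<Rightarrow> (real^3 \<Rightarrow> real) \<Rightarrow> field \<Rightarrow> bool" where
  "has_grad G h g \<longleftrightarrow> h \<in> L2 G \<and> g \<in> L2 G \<and> (\<forall>\<phi>\<in>test G. ip G h (dive \<phi>) = - ip G g \<phi>)"

definition has_div :: "(real^3) set \<Rightarrow> field \<Rightarrow> (real^3 \<Rightarrow> real) \<Rightarrow> bool" where
  "has_div G u d \<longleftrightarrow> u \<in> L2 G \<and> d \<in> L2 G \<and> (\<forall>\<phi>\<in>test G. ip G u (grad \<phi>) = - ip G d \<phi>)"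

definition has_rot :: "(real^3) set \<Rightarrow> field \<Rightarrow> field \<Rightarrow> bool" where
  "has_rot G u w \<longleftrightarrow> u \<in> L2 G \<and> w \<in> L2 G \<and> (\<forall>\<phi>\<in>test G. ip G u (rot \<phi>) = ip G w \<phi>)"

text \<open>For square integrable \<open>u\<close> with square integrable divergence \<open>d\<close>, the trace of the normal
  component is the functional on traces of \<open>H\<^sup>1\<close> functions given by Green's formula: it sends the
  trace of \<open>h\<close> to \<open>\<integral> u \<bullet> \<nabla>h + \<integral> d h\<close>.\<close>

definition normal_trace_zero :: "(real^3) set \<Rightarrow> field \<Rightarrow> bool" where
  "normal_trace_zero G u \<longleftrightarrow>
     (\<exists>d. has_div G u d \<and> (\<forall>h g. has_grad G h g \<longrightarrow> ip G u g + ip G d h = 0))"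

section \<open>The spaces and the operator S\<close>

text \<open>The orthogonal complement of the gradients of \<open>H\<^sup>1\<close> functions.\<close>

definition Bspace :: "(real^3) set \<Rightarrow> field set" where
  "Bspace G = {u \<in> L2 G. \<forall>h g. has_grad G h g \<longrightarrow> ip G u g = 0}"

definition BH :: "(real^3) set \<Rightarrow> field set" where
  "BH G = {u \<in> L2 G. has_div G u (\<lambda>x. 0) \<and> has_rot G u (\<lambda>x. 0) \<and> normal_trace_zero G u}"

definition V0 :: "(real^3) set \<Rightarrow> field set" where
  "V0 G = {u \<in> Bspace G. \<forall>h\<in>BH G. ip G u h = 0}"

definition S_graph :: "(real^3) set \<Rightarrow> (field \<times> field) set" where
  "S_graph G = {(f, F). f \<in> V0 G \<and> F \<in> V0 G \<and> has_rot G f F}"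

definition S_op :: "(real^3) set \<Rightarrow> field \<Rightarrow> field" where
  "S_op G f = (SOME F. (f, F) \<in> S_graph G)"

text \<open>Self-adjointness in the Hilbert space \<open>V\<close> of the operator with graph \<open>T\<close>: the domain is
  dense and the graph equals that of the adjoint.\<close>

definition self_adjoint_in :: "(real^3) set \<Rightarrow> field set \<Rightarrow> (field \<times> field) set \<Rightarrow> bool" where
  "self_adjoint_in G V T \<longleftrightarrow>
     (\<forall>u\<in>V. \<forall>e>0. \<exists>f\<in>Domain T. ip G (\<lambda>x. u x - f x) (\<lambda>x. u x - f x) < e) \<and>
     T = {(g, h). g \<in> V \<and> h \<in> V \<and> (\<forall>(f, F)\<in>T. ip G F g = ip G f h)}"

definition orthonormal_basis ::
    "(real^3) set \<Rightarrow> field set \<Rightarrow> (nat \<Rightarrow> field) \<Rightarrow> (nat \<Rightarrow> field) \<Rightarrow> bool" where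
  "orthonormal_basis G V qp qm \<longleftrightarrow>
     (\<forall>j. qp j \<in> V \<and> qm j \<in> V) \<and>
     (\<forall>i j. ip G (qp i) (qp j) = (if i = j then 1 else 0) \<and>
            ip G (qm i) (qm j) = (if i = j then 1 else 0) \<and>
            ip G (qp i) (qm j) = 0) \<and>
     (\<forall>u\<in>V.
        let r = (\<lambda>n x. u x - (\<Sum>j<n. ip G u (qp j) *\<^sub>R qp j x + ip G u (qm j) *\<^sub>R qm j x))
        in (\<lambda>n. ip G (r n) (r n)) \<longlonglongrightarrow> 0)"

definition Wpos :: "(real^3) set \<Rightarrow> nat \<Rightarrow> field set" where
  "Wpos G m = {f. \<exists>F. F 0 = f \<and> (\<forall>k\<le>m. F k \<in> V0 G) \<and> (\<forall>k<m. has_rot G (F k) (F (Suc k)))}"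

definition ip_pos :: "(real^3) set \<Rightarrow> nat \<Rightarrow> field \<Rightarrow> field \<Rightarrow> real" where
  "ip_pos G m u w = ip G ((S_op G ^^ m) u) ((S_op G ^^ m) w)"

section \<open>Functionals and integer powers of S\<close>

text \<open>Functionals of order \<open>m\<close> act on the sum of \<open>Wpos G m\<close> and \<open>BH G\<close>. The eigenfields are
  indexed from 0: \<open>qp j\<close>, \<open>qm j\<close>, \<open>lam j\<close> stand for the objects with number \<open>j + 1\<close>.\<close>

type_synonym functional = "field \<Rightarrow> real"

definition func_dom :: "(real^3) set \<Rightarrow> nat \<Rightarrow> field set" where
  "func_dom G m = {(\<lambda>x. f x + h x) | f h. f \<in> Wpos G m \<and> h \<in> BH G}"

definition func_of_coeffs :: "(real^3) set \<Rightarrow> (nat \<Rightarrow> field) \<Rightarrow> (nat \<Rightarrow> field) \<Rightarrow> nat \<Rightarrow>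
    (nat \<Rightarrow> real) \<Rightarrow> (nat \<Rightarrow> real) \<Rightarrow> functional" where
  "func_of_coeffs G qp qm m a b =
     restrict (\<lambda>w. \<Sum>j. a j * ip G w (qp j) + b j * ip G w (qm j)) (func_dom G m)"

definition Wneg :: "(real^3) set \<Rightarrow> (nat \<Rightarrow> real) \<Rightarrow> (nat \<Rightarrow> field) \<Rightarrow> (nat \<Rightarrow> field) \<Rightarrow>
    nat \<Rightarrow> functional set" where
  "Wneg G lam qp qm m =
     {v. v = func_of_coeffs G qp qm m (\<lambda>j. v (qp j)) (\<lambda>j. v (qm j)) \<and>
         (\<forall>h\<in>BH G. v h = 0) \<and>
         summable (\<lambda>j. lam j powi (- 2 * int m) * ((v (qp j))\<^sup>2 + (v (qm j))\<^sup>2))}"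

text \<open>A field \<open>u\<close> is identified with the functional \<open>ip G u\<close>, so that in either case the
  coefficients of \<open>v\<close> are \<open>v (qp j)\<close> and \<open>v (qm j)\<close>. There are two versions of the \<open>p\<close>-th power
  of S, according to whether the result is a field in \<open>V0 G\<close> (determined up to \<open>eq_ae\<close>)
  or a functional of order \<open>m\<close>.\<close>

definition Spow_field :: "(real^3) set \<Rightarrow> (nat \<Rightarrow> real) \<Rightarrow> (nat \<Rightarrow> field) \<Rightarrow> (nat \<Rightarrow> field) \<Rightarrow>
    int \<Rightarrow> functional \<Rightarrow> field" where
  "Spow_field G lam qp qm p v =
     (SOME w. w \<in> V0 G \<and> (\<forall>j. ip G w (qp j) = lam j powi p * v (qp j) \<and>
                              ip G w (qm j) = (- lam j) powi p * v (qm j)))"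

definition Spow_func :: "(real^3) set \<Rightarrow> (nat \<Rightarrow> real) \<Rightarrow> (nat \<Rightarrow> field) \<Rightarrow> (nat \<Rightarrow> field) \<Rightarrow>
    nat \<Rightarrow> int \<Rightarrow> functional \<Rightarrow> functional" where
  "Spow_func G lam qp qm m p v =
     func_of_coeffs G qp qm m (\<lambda>j. lam j powi p * v (qp j)) (\<lambda>j. (- lam j) powi p * v (qm j))"

definition ip_neg :: "(real^3) set \<Rightarrow> (nat \<Rightarrow> real) \<Rightarrow> (nat \<Rightarrow> field) \<Rightarrow> (nat \<Rightarrow> field) \<Rightarrow>
    nat \<Rightarrow> functional \<Rightarrow> functional \<Rightarrow> real" where
  "ip_neg G lam qp qm m v w =
     ip G (Spow_field G lam qp qm (- int m) v) (Spow_field G lam qp qm (- int m) w)"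

end

(*
  Everything is read off the coefficients with respect to the eigenfields. By Parseval's identity and
  completeness of L2, V0 is isometric to the square summable coefficient sequences. Since S is
  self-adjoint, its graph consists of the pairs of fields in V0 whose coefficients are related by
  multiplication with the eigenvalues, so Wpos m consists of the fields with summable
  lam^(2m) * coefficient^2; here the eigenvalues are bounded away from 0. The powers of S are then
  diagonal and everything reduces to arithmetic of the powers of the eigenvalues.
*)
theory Submission
  imports Defs
begin

section \<open>Square integrable fields\<close>

lemma L2_measurable: "u \<in> L2 G \<Longrightarrow> u \<in> borel_measurable (lebesgue_on G)"
  and L2_integrable: "u \<in> L2 G \<Longrightarrow> integrable (lebesgue_on G) (\<lambda>x. (norm (u x))\<^sup>2)"
  by (auto simp: L2_def)

lemma L2_zero: "(\<lambda>x. 0) \<in> L2 G"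
  by (simp add: L2_def)

lemma L2_scaleR:
  assumes "u \<in> L2 G"
  shows "(\<lambda>x. c *\<^sub>R u x) \<in> L2 G"
  using assms by (auto simp: L2_def power_mult_distrib)

lemma L2_add:
  assumes u: "u \<in> L2 G" and v: "v \<in> L2 G"
  shows "(\<lambda>x. u x + v x) \<in> L2 G"
proof -
  have bound: "(norm (a + b))\<^sup>2 \<le> 2 * (norm a)\<^sup>2 + 2 * (norm b)\<^sup>2" for a b :: 'a
  proof -
    have "(norm (a + b))\<^sup>2 \<le> (norm a + norm b)\<^sup>2"
      by (intro power_mono norm_triangle_ineq) auto
    also have "\<dots> \<le> 2 * (norm a)\<^sup>2 + 2 * (norm b)\<^sup>2"
      using sum_squares_bound[of "norm a" "norm b"] by (simp add: power2_sum)
    finally show ?thesis .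
  qed
  note [measurable] = L2_measurable[OF u] L2_measurable[OF v]
  have "integrable (lebesgue_on G) (\<lambda>x. (norm (u x + v x))\<^sup>2)"
  proof (rule Bochner_Integration.integrable_bound)
    show "integrable (lebesgue_on G) (\<lambda>x. 2 * (norm (u x))\<^sup>2 + 2 * (norm (v x))\<^sup>2)"
      using L2_integrable[OF u] L2_integrable[OF v] by simp
    show "AE x in lebesgue_on G. norm ((norm (u x + v x))\<^sup>2)
        \<le> norm (2 * (norm (u x))\<^sup>2 + 2 * (norm (v x))\<^sup>2)"
      using bound by (auto intro!: AE_I2)
  qed measurable
  then show ?thesis by (simp add: L2_def)
qed

lemma L2_diff:
  assumes "u \<in> L2 G" and "v \<in> L2 G"
  shows "(\<lambda>x. u x - v x) \<in> L2 G"
  using L2_add[OF assms(1) L2_scaleR[OF assms(2), of "-1"]] by simp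

lemma L2_inner_integrable:
  assumes u: "u \<in> L2 G" and v: "v \<in> L2 G"
  shows "integrable (lebesgue_on G) (\<lambda>x. u x \<bullet> v x)"
proof -
  note [measurable] = L2_measurable[OF u] L2_measurable[OF v]
  have bound: "\<bar>a \<bullet> b\<bar> \<le> (norm a)\<^sup>2 + (norm b)\<^sup>2" for a b :: 'a
  proof -
    have "\<bar>a \<bullet> b\<bar> \<le> norm a * norm b" by (rule Cauchy_Schwarz_ineq2)
    also have "\<dots> \<le> 2 * norm a * norm b" by simp
    also have "\<dots> \<le> (norm a)\<^sup>2 + (norm b)\<^sup>2" by (rule sum_squares_bound)
    finally show ?thesis .
  qed
  show ?thesis
  proof (rule Bochner_Integration.integrable_bound)
    show "integrable (lebesgue_on G) (\<lambda>x. (norm (u x))\<^sup>2 + (norm (v x))\<^sup>2)"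
      using L2_integrable[OF u] L2_integrable[OF v] by simp
    show "AE x in lebesgue_on G. norm (u x \<bullet> v x) \<le> norm ((norm (u x))\<^sup>2 + (norm (v x))\<^sup>2)"
      using bound by (auto intro!: AE_I2)
  qed measurable
qed

section \<open>Inner product calculus and Cauchy-Schwarz\<close>

lemma ip_commute: "ip G u v = ip G v u"
  by (simp add: ip_def inner_commute)

lemma ip_add_left:
  assumes "u \<in> L2 G" "v \<in> L2 G" "w \<in> L2 G"
  shows "ip G (\<lambda>x. u x + v x) w = ip G u w + ip G v w"
  using assms by (simp add: ip_def inner_add_left L2_inner_integrable)

lemma ip_scaleR_left: "ip G (\<lambda>x. c *\<^sub>R u x) w = c * ip G u w"
  by (simp add: ip_def)

lemma ip_scaleR_right: "ip G w (\<lambda>x. c *\<^sub>R u x) = c * ip G w u"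
  by (simp add: ip_def)

lemma ip_zero_left: "ip G (\<lambda>x. 0) w = 0"
  by (simp add: ip_def)

lemma ip_diff_left:
  assumes "u \<in> L2 G" "v \<in> L2 G" "w \<in> L2 G"
  shows "ip G (\<lambda>x. u x - v x) w = ip G u w - ip G v w"
  using assms by (simp add: ip_def inner_diff_left L2_inner_integrable)

lemma ip_self: "ip G u u = (LINT x|lebesgue_on G. (norm (u x))\<^sup>2)"
  by (simp add: ip_def power2_norm_eq_inner)

lemma ip_self_nonneg: "0 \<le> ip G u u"
  by (simp add: ip_self)

lemma ip_self_minus: "ip G (\<lambda>x. u x - v x) (\<lambda>x. u x - v x) = ip G (\<lambda>x. v x - u x) (\<lambda>x. v x - u x)"
  by (simp add: ip_self norm_minus_commute)

lemma eq_ae_if_ip_zero: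
  assumes u: "u \<in> L2 G" and v: "v \<in> L2 G"
    and "ip G (\<lambda>x. u x - v x) (\<lambda>x. u x - v x) = 0"
  shows "eq_ae G u v"
proof -
  have "AE x in lebesgue_on G. (norm (u x - v x))\<^sup>2 = 0"
    using assms(3) integral_nonneg_eq_0_iff_AE[OF L2_integrable[OF L2_diff[OF u v]]]
    by (simp add: ip_self)
  then show ?thesis by (simp add: eq_ae_def)
qed

lemma ip_Cauchy_Schwarz:
  assumes u: "u \<in> L2 G" and v: "v \<in> L2 G"
  shows "(ip G u v)\<^sup>2 \<le> ip G u u * ip G v v"
proof -
  define A B C where "A = ip G u u" and "B = ip G u v" and "C = ip G v v"
  have quad: "0 \<le> A - 2 * t * B + t\<^sup>2 * C" for t
  proof -
    let ?w = "\<lambda>x. u x - t *\<^sub>R v x"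
    have tv: "(\<lambda>x. t *\<^sub>R v x) \<in> L2 G" by (rule L2_scaleR[OF v])
    have w: "?w \<in> L2 G" by (rule L2_diff[OF u tv])
    have "ip G ?w ?w = ip G ?w u - t * ip G ?w v"
      using ip_diff_left[OF u tv w] by (simp add: ip_scaleR_left ip_commute[of G u ?w] ip_commute[of G v ?w])
    also have "\<dots> = A - 2 * t * B + t\<^sup>2 * C"
      by (simp add: ip_diff_left[OF u tv] u v ip_scaleR_left A_def B_def C_def
          ip_commute[of G v u] algebra_simps power2_eq_square)
    finally show ?thesis using ip_self_nonneg[of G ?w] by simp
  qed
  have "B\<^sup>2 \<le> A * C"
  proof (cases "C = 0")
    case True
    have "B = 0"
    proof (rule ccontr)
      assume "B \<noteq> 0"
      \<comment> \<open>With C = 0 the polynomial is linear in t, and this t gives it the value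
        -1.\<close>
      then show False using quad[of "(A + 1) / (2 * B)"] True by simp
    qed
    then show ?thesis using True by simp
  next
    case False
    then have "0 < C" using ip_self_nonneg[of G v] by (simp add: C_def)
    \<comment> \<open>B / C is the minimiser of the quadratic polynomial.\<close>
    then show ?thesis using quad[of "B / C"]
      by (simp add: field_simps power2_eq_square)
  qed
  then show ?thesis by (simp add: A_def B_def C_def)
qed

text \<open>Cauchy-Schwarz turns norm convergence into weak convergence; this is what lets
  coefficients pass to limits.\<close>

lemma ip_tendsto_zero:
  assumes r: "\<And>n. r n \<in> L2 G" and g: "g \<in> L2 G"
    and lim: "(\<lambda>n. ip G (r n) (r n)) \<longlonglongrightarrow> 0"
  shows "(\<lambda>n. ip G (r n) g) \<longlonglongrightarrow> 0"
proof -
  have "(\<lambda>n. (ip G (r n) g)\<^sup>2) \<longlonglongrightarrow> 0"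
  proof (rule tendsto_sandwich[OF _ _ tendsto_const])
    show "\<forall>\<^sub>F n in sequentially. (ip G (r n) g)\<^sup>2 \<le> ip G (r n) (r n) * ip G g g"
      using ip_Cauchy_Schwarz[OF r g] by simp
    show "(\<lambda>n. ip G (r n) (r n) * ip G g g) \<longlonglongrightarrow> 0"
      using tendsto_mult_right[OF lim, of "ip G g g"] by simp
  qed simp
  then show ?thesis by (simp add: tendsto_null_power)
qed

section \<open>Completeness of \<open>L2\<close>\<close>

lemma L2_Fatou:
  fixes f :: "nat \<Rightarrow> real^3 \<Rightarrow> 'b::euclidean_space"
  assumes f: "\<And>k. f k \<in> L2 G" and g: "g \<in> borel_measurable (lebesgue_on G)"
    and lim: "AE x in lebesgue_on G. (\<lambda>k. f k x) \<longlonglongrightarrow> g x"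
    and bd: "\<forall>\<^sub>F k in sequentially. ip G (f k) (f k) \<le> e"
  shows "g \<in> L2 G" and "ip G g g \<le> e"
proof -
  let ?M = "lebesgue_on G"
  note [measurable] = g L2_measurable[OF f]
  \<comment> \<open>One term below e shows that e is nonnegative. Since \<open>ennreal\<close> sends
    negative numbers to 0, the last step needs this to pass from \<open>ennreal e\<close> back to
    e.\<close>
  obtain k where "ip G (f k) (f k) \<le> e"
    using bd by (auto simp: eventually_sequentially)
  then have e: "0 \<le> e" using ip_self_nonneg order_trans by blast
  have nn: "(\<integral>\<^sup>+x. ennreal ((norm (f k x))\<^sup>2) \<partial>?M) = ennreal (ip G (f k) (f k))" for k
    unfolding ip_self by (rule nn_integral_eq_integral[OF L2_integrable[OF f]]) auto
  have "(\<integral>\<^sup>+x. ennreal ((norm (g x))\<^sup>2) \<partial>?M)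
      = (\<integral>\<^sup>+x. liminf (\<lambda>k. ennreal ((norm (f k x))\<^sup>2)) \<partial>?M)"
  proof (rule nn_integral_cong_AE)
    show "AE x in ?M. ennreal ((norm (g x))\<^sup>2) = liminf (\<lambda>k. ennreal ((norm (f k x))\<^sup>2))"
      using lim
    proof eventually_elim
      case (elim x)
      have "(\<lambda>k. ennreal ((norm (f k x))\<^sup>2)) \<longlonglongrightarrow> ennreal ((norm (g x))\<^sup>2)"
        by (intro tendsto_intros elim)
      from lim_imp_Liminf[OF _ this] show ?case by simp
    qed
  qed
  also have "\<dots> \<le> liminf (\<lambda>k. \<integral>\<^sup>+x. ennreal ((norm (f k x))\<^sup>2) \<partial>?M)"
    by (rule nn_integral_liminf) measurable
  also have "\<dots> \<le> limsup (\<lambda>k. \<integral>\<^sup>+x. ennreal ((norm (f k x))\<^sup>2) \<partial>?M)"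
    by (rule Liminf_le_Limsup) simp
  also have "\<dots> \<le> ennreal e"
    unfolding nn using bd by (intro Limsup_bounded) (auto elim!: eventually_mono intro: ennreal_leI)
  finally have le: "(\<integral>\<^sup>+x. ennreal ((norm (g x))\<^sup>2) \<partial>?M) \<le> ennreal e" .
  have int: "integrable ?M (\<lambda>x. (norm (g x))\<^sup>2)"
    by (rule integrableI_bounded) (use le in \<open>auto intro: order.strict_trans1\<close>)
  then show "g \<in> L2 G" by (simp add: L2_def g)
  have "(\<integral>\<^sup>+x. ennreal ((norm (g x))\<^sup>2) \<partial>?M) = ennreal (ip G g g)"
    unfolding ip_self by (rule nn_integral_eq_integral[OF int]) auto
  then show "ip G g g \<le> e" using le e by simp
qed

text \<open>A rapidly converging subsequence converges almost everywhere, and Fatou's lemma carries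
  the Cauchy estimate of the full sequence over to that pointwise limit.\<close>

lemma L2_complete:
  fixes f :: "nat \<Rightarrow> real^3 \<Rightarrow> 'b::euclidean_space"
  assumes f: "\<And>n. f n \<in> L2 G"
    and Cauchy: "\<And>e. 0 < e \<Longrightarrow>
      \<exists>N. \<forall>m\<ge>N. \<forall>n\<ge>N. ip G (\<lambda>x. f m x - f n x) (\<lambda>x. f m x - f n x) < e"
  obtains g where "g \<in> L2 G"
    and "(\<lambda>n. ip G (\<lambda>x. f n x - g x) (\<lambda>x. f n x - g x)) \<longlonglongrightarrow> 0"
proof -
  let ?M = "lebesgue_on G"
  \<comment> \<open>The rate 1/4 still leaves the summable rate 1/2 after multiplication by the
    weights \<open>2 ^ k\<close>.\<close>
  have "\<exists>N. \<forall>k. \<forall>m\<ge>N k. \<forall>n\<ge>N k.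
      ip G (\<lambda>x. f m x - f n x) (\<lambda>x. f m x - f n x) < (1/4) ^ k"
    by (intro choice allI Cauchy) simp
  then obtain N where N: "\<And>k m n. m \<ge> N k \<Longrightarrow> n \<ge> N k \<Longrightarrow>
      ip G (\<lambda>x. f m x - f n x) (\<lambda>x. f m x - f n x) < (1/4) ^ k"
    by blast
  \<comment> \<open>The partial sums make r nondecreasing and at least \<open>N k\<close>; the
    summand k forces r to tend to infinity.\<close>
  define r where "r k = (\<Sum>i\<le>k. N i) + k" for k
  have rN: "N k \<le> r k" for k
    unfolding r_def by (intro trans_le_add1 member_le_sum) auto
  have rSuc: "r k \<le> r (Suc k)" and rk: "k \<le> r k" for k
    by (auto simp: r_def)
  define d where "d k x = f (r (Suc k)) x - f (r k) x" for k x
  have d: "d k \<in> L2 G" for k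
    unfolding d_def by (intro L2_diff f)
  note [measurable] = L2_measurable[OF d] L2_measurable[OF f]
  have d_small: "ip G (d k) (d k) \<le> (1/4) ^ k" for k
    unfolding d_def using N[of k "r (Suc k)" "r k"] rN rSuc order_trans by (meson less_imp_le)
  have nn: "(\<integral>\<^sup>+x. ennreal (2 ^ k * (norm (d k x))\<^sup>2) \<partial>?M) = ennreal (2 ^ k * ip G (d k) (d k))" for k
    using nn_integral_eq_integral[of ?M "\<lambda>x. 2 ^ k * (norm (d k x))\<^sup>2"] L2_integrable[OF d]
    by (simp add: ip_self)
  \<comment> \<open>The weights make \<open>norm (d k x)\<close> itself summable: \<open>t \<le> 1 / p + p * t\<^sup>2\<close> with \<open>p = 2 ^ k\<close>.\<close>
  have "(\<integral>\<^sup>+x. (\<Sum>k. ennreal (2 ^ k * (norm (d k x))\<^sup>2)) \<partial>?M)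
      = (\<Sum>k. \<integral>\<^sup>+x. ennreal (2 ^ k * (norm (d k x))\<^sup>2) \<partial>?M)"
    by (rule nn_integral_suminf) measurable
  also have "\<dots> \<le> (\<Sum>k. ennreal ((1/2) ^ k))"
  proof (rule suminf_le)
    fix k
    have "2 ^ k * ip G (d k) (d k) \<le> 2 ^ k * (1/4) ^ k"
      using d_small by (intro mult_left_mono) auto
    also have "\<dots> = (1/2) ^ k" by (simp flip: power_mult_distrib)
    finally show "(\<integral>\<^sup>+x. ennreal (2 ^ k * (norm (d k x))\<^sup>2) \<partial>?M) \<le> ennreal ((1/2) ^ k)"
      unfolding nn by (rule ennreal_leI)
  qed auto
  also have "\<dots> = ennreal (\<Sum>k. (1/2) ^ k)"
    by (intro suminf_ennreal2 summable_geometric) auto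
  also have "\<dots> < \<infinity>" by simp
  finally have fin: "(\<integral>\<^sup>+x. (\<Sum>k. ennreal (2 ^ k * (norm (d k x))\<^sup>2)) \<partial>?M) \<noteq> \<infinity>"
    by simp
  have "AE x in ?M. (\<Sum>k. ennreal (2 ^ k * (norm (d k x))\<^sup>2)) \<noteq> \<infinity>"
    by (rule nn_integral_noteq_infinite[OF _ fin]) measurable
  then have conv: "AE x in ?M. (\<lambda>k. f (r k) x) \<longlonglongrightarrow> lim (\<lambda>k. f (r k) x)"
  proof eventually_elim
    case (elim x)
    have s: "summable (\<lambda>k. 2 ^ k * (norm (d k x))\<^sup>2)"
      by (rule summable_suminf_not_top) (use elim in auto)
    have "summable (\<lambda>k. (1/2) ^ k + 2 ^ k * (norm (d k x))\<^sup>2)"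
      by (intro summable_add s summable_geometric) simp
    then have "summable (\<lambda>k. d k x)"
    proof (rule summable_comparison_test')
      fix k :: nat
      define t where "t = norm (d k x)"
      define p :: real where "p = 2 ^ k"
      have p: "0 < p" and t: "0 \<le> t" by (auto simp: p_def t_def)
      have "0 \<le> (p * t - 1)\<^sup>2 + p * t" using p t by simp
      then have "p * t \<le> 1 + p\<^sup>2 * t\<^sup>2" by (simp add: power2_diff power_mult_distrib)
      then have "t \<le> 1 / p + p * t\<^sup>2" using p by (simp add: field_simps power2_eq_square)
      then show "norm (d k x) \<le> (1/2) ^ k + 2 ^ k * (norm (d k x))\<^sup>2"
        by (simp add: t_def p_def power_one_over)
    qed
    then have "convergent (\<lambda>n. \<Sum>k<n. d k x)" by (simp add: summable_iff_convergent)
    moreover have "(\<Sum>k<n. d k x) = f (r n) x - f (r 0) x" for n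
      unfolding d_def by (rule sum_lessThan_telescope)
    ultimately have "convergent (\<lambda>n. f (r n) x - f (r 0) x)" by simp
    then have "convergent (\<lambda>n. f (r n) x)" by (simp add: convergent_diff_const_right_iff)
    then show ?case by (simp add: convergent_LIMSEQ_iff)
  qed
  \<comment> \<open>On the null set without convergence \<open>lim\<close> has some unspecified
    value; g is nevertheless measurable everywhere.\<close>
  define g where "g x = lim (\<lambda>k. f (r k) x)" for x
  have [measurable]: "g \<in> borel_measurable ?M"
    unfolding g_def by (rule borel_measurable_lim_metric) measurable
  \<comment> \<open>Fatou's lemma in k for \<open>f (r k) - f n\<close> with n fixed; since r k is
    at least k, the assumption applies to all large k.\<close>
  have approx: "(\<lambda>x. g x - f n x) \<in> L2 G \<and> ip G (\<lambda>x. g x - f n x) (\<lambda>x. g x - f n x) \<le> e"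
    if K: "\<And>m. m \<ge> K \<Longrightarrow> ip G (\<lambda>x. f m x - f n x) (\<lambda>x. f m x - f n x) < e" for n K e
  proof -
    have "AE x in ?M. (\<lambda>k. f (r k) x - f n x) \<longlonglongrightarrow> g x - f n x"
      using conv by eventually_elim (simp add: g_def tendsto_diff)
    moreover have "\<forall>\<^sub>F k in sequentially.
        ip G (\<lambda>x. f (r k) x - f n x) (\<lambda>x. f (r k) x - f n x) \<le> e"
      unfolding eventually_sequentially using K rk by (meson less_imp_le order_trans)
    moreover have "(\<lambda>x. g x - f n x) \<in> borel_measurable ?M" by measurable
    ultimately show ?thesis
      using L2_Fatou[of "\<lambda>k x. f (r k) x - f n x" G "\<lambda>x. g x - f n x" e]
      by (auto intro: L2_diff f)
  qed
  \<comment> \<open>It suffices that g differs from a single \<open>f n\<close> by a square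
    integrable field.\<close>
  obtain n where "(\<lambda>x. g x - f n x) \<in> L2 G"
    using approx[of "N 0" "N 0" "(1/4) ^ 0"] N[of 0] by blast
  from L2_add[OF this f[of n]] have "g \<in> L2 G" by simp
  moreover have "(\<lambda>n. ip G (\<lambda>x. f n x - g x) (\<lambda>x. f n x - g x)) \<longlonglongrightarrow> 0"
  proof (rule LIMSEQ_I)
    fix e :: real assume "0 < e"
    \<comment> \<open>Half of e, because the passage to the limit keeps only a weak
      inequality.\<close>
    then obtain K where "\<And>m n. m \<ge> K \<Longrightarrow> n \<ge> K \<Longrightarrow>
        ip G (\<lambda>x. f m x - f n x) (\<lambda>x. f m x - f n x) < e / 2"
      using Cauchy[of "e / 2"] by auto
    then have "ip G (\<lambda>x. g x - f n x) (\<lambda>x. g x - f n x) \<le> e / 2" if "n \<ge> K" for n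
      using approx that by blast
    then have "norm (ip G (\<lambda>x. f n x - g x) (\<lambda>x. f n x - g x) - 0) < e" if "n \<ge> K" for n
      using that \<open>0 < e\<close> ip_self_nonneg[of G "\<lambda>x. f n x - g x"] ip_self_minus[of G "f n" g]
      by (fastforce simp: abs_of_nonneg)
    then show "\<exists>no. \<forall>n\<ge>no. norm (ip G (\<lambda>x. f n x - g x) (\<lambda>x. f n x - g x) - 0) < e" by blast
  qed
  ultimately show ?thesis using that by blast
qed

section \<open>The spaces\<close>

lemma V0_L2: "u \<in> V0 G \<Longrightarrow> u \<in> L2 G"
  by (auto simp: V0_def Bspace_def)

lemma BH_L2: "u \<in> BH G \<Longrightarrow> u \<in> L2 G"
  by (auto simp: BH_def)

text \<open>Taking the two successive orthogonal complements as one, of a single set of fields, lets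
  linearity and closedness be proved once for both kinds of test fields.\<close>

lemma V0_iff:
  "u \<in> V0 G \<longleftrightarrow> u \<in> L2 G \<and> (\<forall>g \<in> {g. \<exists>h. has_grad G h g} \<union> BH G. ip G u g = 0)"
  by (auto simp: V0_def Bspace_def)

lemma V0_orthogonal_L2: "g \<in> {g. \<exists>h. has_grad G h g} \<union> BH G \<Longrightarrow> g \<in> L2 G"
  by (auto simp: has_grad_def BH_L2)

lemma V0_zero: "(\<lambda>x. 0) \<in> V0 G"
  by (simp add: V0_iff L2_zero ip_zero_left)

lemma V0_add: "u \<in> V0 G \<Longrightarrow> v \<in> V0 G \<Longrightarrow> (\<lambda>x. u x + v x) \<in> V0 G"
  unfolding V0_iff by (simp add: L2_add ip_add_left V0_orthogonal_L2)

lemma V0_scaleR: "u \<in> V0 G \<Longrightarrow> (\<lambda>x. c *\<^sub>R u x) \<in> V0 G"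
  by (simp add: V0_iff L2_scaleR ip_scaleR_left)

lemma V0_diff: "u \<in> V0 G \<Longrightarrow> v \<in> V0 G \<Longrightarrow> (\<lambda>x. u x - v x) \<in> V0 G"
  unfolding V0_iff by (simp add: L2_diff ip_diff_left V0_orthogonal_L2)

text \<open>Orthogonal complements are closed because the inner product with a fixed field is
  continuous. The continuity is stated as well, since it also yields Parseval's identity and the
  coefficients of limits.\<close>

lemma V0_closed:
  assumes s: "\<And>n. s n \<in> V0 G" and w: "w \<in> L2 G"
    and lim: "(\<lambda>n. ip G (\<lambda>x. s n x - w x) (\<lambda>x. s n x - w x)) \<longlonglongrightarrow> 0"
  shows "w \<in> V0 G" and "g \<in> L2 G \<Longrightarrow> (\<lambda>n. ip G (s n) g) \<longlonglongrightarrow> ip G w g"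
proof -
  show *: "(\<lambda>n. ip G (s n) g) \<longlonglongrightarrow> ip G w g" if g: "g \<in> L2 G" for g
  proof -
    have "(\<lambda>n. ip G (\<lambda>x. s n x - w x) g) \<longlonglongrightarrow> 0"
      by (rule ip_tendsto_zero[OF L2_diff[OF V0_L2[OF s] w] g lim])
    then show ?thesis
      by (simp add: ip_diff_left[OF V0_L2[OF s] w g] LIM_zero_iff)
  qed
  show "w \<in> V0 G"
    unfolding V0_iff
  proof (intro conjI w ballI)
    fix g assume g: "g \<in> {g. \<exists>h. has_grad G h g} \<union> BH G"
    then have "ip G (s n) g = 0" for n using s[of n] unfolding V0_iff by blast
    with *[OF V0_orthogonal_L2[OF g]] show "ip G w g = 0"
      by (simp add: LIMSEQ_const_iff)
  qed
qed

lemma BH_zero: "(\<lambda>x. 0) \<in> BH G"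
proof -
  have d: "has_div G (\<lambda>x. 0) (\<lambda>x. 0)" and "has_rot G (\<lambda>x. 0) (\<lambda>x. 0)"
    by (simp_all add: has_div_def has_rot_def L2_zero ip_zero_left)
  moreover have "normal_trace_zero G (\<lambda>x. 0)"
    unfolding normal_trace_zero_def by (intro exI[of _ "\<lambda>x. 0"] conjI d) (simp add: ip_zero_left)
  ultimately show ?thesis by (simp add: BH_def L2_zero)
qed

text \<open>Chains of weak rotations become chains in the graph of S, where self-adjointness can be
  used. The condition on f itself is listed separately because for m = 0 the chain is empty.\<close>

lemma Wpos_iff_S_graph:
  "f \<in> Wpos G m \<longleftrightarrow> (\<exists>F. F 0 = f \<and> f \<in> V0 G \<and> (\<forall>k<m. (F k, F (Suc k)) \<in> S_graph G))"
proof
  assume "f \<in> Wpos G m"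
  then obtain F where "F 0 = f" "\<forall>k\<le>m. F k \<in> V0 G" "\<forall>k<m. has_rot G (F k) (F (Suc k))"
    unfolding Wpos_def by blast
  then show "\<exists>F. F 0 = f \<and> f \<in> V0 G \<and> (\<forall>k<m. (F k, F (Suc k)) \<in> S_graph G)"
    by (intro exI[of _ F]) (auto simp: S_graph_def)
next
  assume "\<exists>F. F 0 = f \<and> f \<in> V0 G \<and> (\<forall>k<m. (F k, F (Suc k)) \<in> S_graph G)"
  then obtain F where F: "F 0 = f" "f \<in> V0 G" "\<forall>k<m. (F k, F (Suc k)) \<in> S_graph G" by blast
  have "F k \<in> V0 G" if "k \<le> m" for k
    using F that by (cases k) (auto simp: S_graph_def)
  then show "f \<in> Wpos G m"
    unfolding Wpos_def using F by (auto simp: S_graph_def intro!: exI[of _ F])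
qed

section \<open>Coefficients with respect to the eigenfields\<close>

locale rot_eigenbasis =
  fixes G :: "(real^3) set" and lam :: "nat \<Rightarrow> real" and qp qm :: "nat \<Rightarrow> field"
  assumes self_adjoint: "self_adjoint_in G (V0 G) (S_graph G)"
    and lam_pos: "\<And>j. 0 < lam j" and lam_mono: "mono lam"
    and basis: "orthonormal_basis G (V0 G) qp qm"
    and rot_qp: "\<And>j. has_rot G (qp j) (\<lambda>x. lam j *\<^sub>R qp j x)"
    and rot_qm: "\<And>j. has_rot G (qm j) (\<lambda>x. - lam j *\<^sub>R qm j x)"
begin

abbreviation cp :: "field \<Rightarrow> nat \<Rightarrow> real" where "cp u j \<equiv> ip G u (qp j)"
abbreviation cm :: "field \<Rightarrow> nat \<Rightarrow> real" where "cm u j \<equiv> ip G u (qm j)"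

lemma lam_nz [simp]: "lam j \<noteq> 0"
  using lam_pos[of j] by simp

lemma qp_V0: "qp j \<in> V0 G" and qm_V0: "qm j \<in> V0 G"
  using basis by (auto simp: orthonormal_basis_def)

lemmas q_L2 = qp_V0[THEN V0_L2] qm_V0[THEN V0_L2]

lemma q_orthonormal:
  "cp (qp i) j = (if i = j then 1 else 0)" "cm (qm i) j = (if i = j then 1 else 0)"
  "cm (qp i) j = 0" "cp (qm i) j = 0"
  using basis ip_commute[of G "qm i" "qp j"] unfolding orthonormal_basis_def by auto

section \<open>Eigenfield expansions: Parseval and Riesz-Fischer\<close>

definition psum :: "(nat \<Rightarrow> real) \<Rightarrow> (nat \<Rightarrow> real) \<Rightarrow> nat \<Rightarrow> field" where
  "psum a b n x = (\<Sum>j<n. a j *\<^sub>R qp j x + b j *\<^sub>R qm j x)"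

lemma psum_V0: "psum a b n \<in> V0 G"
proof (induction n)
  case 0
  then show ?case by (simp add: psum_def[abs_def] V0_zero)
next
  case (Suc n)
  have "(\<lambda>x. psum a b n x + (a n *\<^sub>R qp n x + b n *\<^sub>R qm n x)) \<in> V0 G"
    by (intro V0_add Suc V0_scaleR qp_V0 qm_V0)
  then show ?case by (simp add: psum_def[abs_def])
qed

lemma ip_psum:
  assumes g: "g \<in> L2 G"
  shows "ip G (psum a b n) g = (\<Sum>j<n. a j * cp g j + b j * cm g j)"
proof (induction n)
  case 0
  then show ?case by (simp add: psum_def[abs_def] ip_zero_left)
next
  case (Suc n)
  have t: "(\<lambda>x. a n *\<^sub>R qp n x) \<in> L2 G" "(\<lambda>x. b n *\<^sub>R qm n x) \<in> L2 G"
    by (intro L2_scaleR q_L2)+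
  have "ip G (psum a b (Suc n)) g = ip G (\<lambda>x. psum a b n x + (a n *\<^sub>R qp n x + b n *\<^sub>R qm n x)) g"
    by (simp add: psum_def[abs_def])
  also have "\<dots> = ip G (psum a b n) g + (a n * cp g n + b n * cm g n)"
    using ip_add_left[OF V0_L2[OF psum_V0] L2_add[OF t] g] ip_add_left[OF t g]
    by (simp add: ip_scaleR_left ip_commute[of G g "qp n"] ip_commute[of G g "qm n"])
  finally show ?case using Suc by simp
qed

lemma psum_coeffs:
  "cp (psum a b n) j = (if j < n then a j else 0)"
  "cm (psum a b n) j = (if j < n then b j else 0)"
  by (simp_all add: ip_psum q_L2 q_orthonormal if_distrib[of "(*) _"] cong: if_cong)

text \<open>The expansion of u converges in norm, so its inner products with v converge, and on
  partial sums these are finite sums of coefficient products.\<close>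

lemma parseval:
  assumes u: "u \<in> V0 G" and v: "v \<in> V0 G"
  shows "(\<lambda>j. cp u j * cp v j + cm u j * cm v j) sums ip G u v"
proof -
  let ?s = "psum (cp u) (cm u)"
  have "(\<lambda>n. ip G (\<lambda>x. u x - ?s n x) (\<lambda>x. u x - ?s n x)) \<longlonglongrightarrow> 0"
    using basis u unfolding orthonormal_basis_def Let_def psum_def by blast
  then have "(\<lambda>n. ip G (\<lambda>x. ?s n x - u x) (\<lambda>x. ?s n x - u x)) \<longlonglongrightarrow> 0"
    by (simp add: ip_self_minus[of G u])
  from V0_closed(2)[OF psum_V0 V0_L2[OF u] this V0_L2[OF v]] show ?thesis
    by (simp add: sums_def ip_psum V0_L2[OF v])
qed

text \<open>Only the products have to agree, not the coefficients: in the symmetry of S the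
  eigenvalue moves from one factor to the other.\<close>

lemma ip_eq_if_coeffs_eq:
  assumes "u \<in> V0 G" "v \<in> V0 G" "u' \<in> V0 G" "v' \<in> V0 G"
    and "\<And>j. cp u j * cp v j + cm u j * cm v j = cp u' j * cp v' j + cm u' j * cm v' j"
  shows "ip G u v = ip G u' v'"
  using parseval[OF assms(1,2)] parseval[OF assms(3,4)] assms(5) by (simp add: sums_unique2)

lemma eq_ae_if_coeffs_eq:
  assumes u: "u \<in> V0 G" and v: "v \<in> V0 G" and "\<And>j. cp u j = cp v j" "\<And>j. cm u j = cm v j"
  shows "eq_ae G u v"
proof (rule eq_ae_if_ip_zero)
  let ?w = "\<lambda>x. u x - v x"
  show "u \<in> L2 G" "v \<in> L2 G" using u v by (auto intro: V0_L2)
  then have "cp ?w j = 0" "cm ?w j = 0" for j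
    using assms(3,4) by (simp_all add: ip_diff_left q_L2)
  then show "ip G ?w ?w = 0"
    using sums_unique2[OF parseval[OF V0_diff[OF u v] V0_diff[OF u v]]] by simp
qed

lemma coeffs_summable:
  assumes "u \<in> V0 G"
  shows "summable (\<lambda>j. (cp u j)\<^sup>2 + (cm u j)\<^sup>2)"
  using parseval[OF assms assms] by (simp add: sums_iff power2_eq_square)

text \<open>Parseval for a field with finitely many nonzero coefficients. It converts the Cauchy
  criterion for series into the Cauchy property in \<open>L2\<close>.\<close>

lemma ip_psum_diff:
  assumes "n \<le> m"
  shows "ip G (\<lambda>x. psum a b m x - psum a b n x) (\<lambda>x. psum a b m x - psum a b n x)
    = (\<Sum>j=n..<m. (a j)\<^sup>2 + (b j)\<^sup>2)"
proof -
  let ?w = "\<lambda>x. psum a b m x - psum a b n x"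
  have w: "?w \<in> V0 G" by (intro V0_diff psum_V0)
  have c: "cp ?w j = (if j \<in> {n..<m} then a j else 0)"
    "cm ?w j = (if j \<in> {n..<m} then b j else 0)" for j
    using assms by (simp_all add: ip_diff_left V0_L2[OF psum_V0] q_L2 psum_coeffs)
  have "(\<lambda>j. cp ?w j * cp ?w j + cm ?w j * cm ?w j) sums
      (\<Sum>j=n..<m. cp ?w j * cp ?w j + cm ?w j * cm ?w j)"
    by (rule sums_finite) (auto simp: c)
  from sums_unique2[OF parseval[OF w w] this] show ?thesis
    by (simp add: c power2_eq_square)
qed

text \<open>The partial sums are Cauchy, their limit stays in the closed space \<open>V0 G\<close>,
  and each coefficient of the partial sums is eventually constant. All later fields with prescribed
  coefficients come from here.\<close>

lemma riesz_fischer: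
  assumes sum: "summable (\<lambda>j. (a j)\<^sup>2 + (b j)\<^sup>2)"
  shows "\<exists>w\<in>V0 G. \<forall>j. cp w j = a j \<and> cm w j = b j"
proof -
  define D where "D m n = ip G (\<lambda>x. psum a b m x - psum a b n x) (\<lambda>x. psum a b m x - psum a b n x)"
    for m n
  have sym: "D m n = D n m" for m n
    unfolding D_def by (rule ip_self_minus)
  have "\<exists>N. \<forall>m\<ge>N. \<forall>n\<ge>N. D m n < e" if e: "0 < e" for e
  proof -
    obtain N where N: "\<And>m n. m \<ge> N \<Longrightarrow> norm (\<Sum>j=m..<n. (a j)\<^sup>2 + (b j)\<^sup>2) < e"
      using sum e unfolding summable_Cauchy by blast
    have le: "D m n < e" if "n \<ge> N" "n \<le> m" for m n
      using N[OF that(1), of m] that(2) unfolding D_def ip_psum_diff[OF that(2)] real_norm_def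
      by linarith
    have "D m n < e" if "n \<ge> N" "m \<ge> N" for m n
      using le[of n m] le[of m n] sym[of m n] that nat_le_linear[of m n] by metis
    then show ?thesis by blast
  qed
  then obtain w where w: "w \<in> L2 G"
    "(\<lambda>n. ip G (\<lambda>x. psum a b n x - w x) (\<lambda>x. psum a b n x - w x)) \<longlonglongrightarrow> 0"
    using L2_complete[of "psum a b" G, OF V0_L2[OF psum_V0]] unfolding D_def by blast
  have ev: "\<forall>\<^sub>F n in sequentially. (if j < n then c else 0) = (c::real)" for j c
    using eventually_gt_at_top[of j] by eventually_elim simp
  have lim: "(\<lambda>n. if j < n then c else 0) \<longlonglongrightarrow> (c::real)" for j c
    by (rule tendsto_eventually[OF ev])
  have "cp w j = a j" "cm w j = b j" for j
    using V0_closed(2)[OF psum_V0 w q_L2(1)[of j]] V0_closed(2)[OF psum_V0 w q_L2(2)[of j]] lim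
    by (auto simp: psum_coeffs intro: LIMSEQ_unique)
  then show ?thesis using V0_closed(1)[OF psum_V0 w] by blast
qed

section \<open>The operator S and its powers in coefficients\<close>

lemma S_graph_adjoint:
  "S_graph G = {(g, h). g \<in> V0 G \<and> h \<in> V0 G \<and> (\<forall>(f, F)\<in>S_graph G. ip G F g = ip G f h)}"
  using self_adjoint unfolding self_adjoint_in_def by blast

text \<open>One half of self-adjointness: the graph is contained in the graph of the
  adjoint.\<close>

lemma S_graph_symmetric:
  assumes "(f, F) \<in> S_graph G" "(g, h) \<in> S_graph G"
  shows "ip G F g = ip G f h"
proof -
  have "(g, h) \<in> {(g, h). g \<in> V0 G \<and> h \<in> V0 G \<and> (\<forall>(f, F)\<in>S_graph G. ip G F g = ip G f h)}"
    using assms(2) S_graph_adjoint by simp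
  then show ?thesis using assms(1) by blast
qed

text \<open>Symmetry is tested against the eigenfields, which lie in the domain of S.\<close>

lemma S_graph_coeffs:
  assumes "(f, g) \<in> S_graph G"
  shows "cp g j = lam j * cp f j" and "cm g j = - lam j * cm f j"
proof -
  have "(qp j, \<lambda>x. lam j *\<^sub>R qp j x) \<in> S_graph G"
    unfolding S_graph_def using rot_qp[of j] V0_scaleR[OF qp_V0, of "lam j" j] qp_V0 by blast
  from S_graph_symmetric[OF assms this] show "cp g j = lam j * cp f j"
    unfolding ip_scaleR_right .
  have "(qm j, \<lambda>x. - lam j *\<^sub>R qm j x) \<in> S_graph G"
    unfolding S_graph_def using rot_qm[of j] V0_scaleR[OF qm_V0, of "- lam j" j] qm_V0 by blast
  from S_graph_symmetric[OF assms this] show "cm g j = - lam j * cm f j"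
    unfolding ip_scaleR_right .
qed

text \<open>By self-adjointness, the weak rotation of a field in \<open>V0 G\<close> can be read off its
  coefficients, without any regularity theory.\<close>

lemma S_graph_iff:
  "(f, g) \<in> S_graph G \<longleftrightarrow>
     f \<in> V0 G \<and> g \<in> V0 G \<and> (\<forall>j. cp g j = lam j * cp f j \<and> cm g j = - lam j * cm f j)"
proof
  assume fg: "(f, g) \<in> S_graph G"
  then show "f \<in> V0 G \<and> g \<in> V0 G \<and> (\<forall>j. cp g j = lam j * cp f j \<and> cm g j = - lam j * cm f j)"
    using S_graph_coeffs[OF fg] by (auto simp: S_graph_def)
next
  assume A: "f \<in> V0 G \<and> g \<in> V0 G \<and> (\<forall>j. cp g j = lam j * cp f j \<and> cm g j = - lam j * cm f j)"
  \<comment> \<open>The other half of self-adjointness: membership in the adjoint graph suffices,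
    and by Parseval this is a termwise identity in which the eigenvalue changes sides.\<close>
  have "ip G F' f = ip G f' g" if f': "(f', F') \<in> S_graph G" for f' F'
  proof (rule ip_eq_if_coeffs_eq)
    show "f' \<in> V0 G" "F' \<in> V0 G" using f' by (auto simp: S_graph_def)
    show "cp F' j * cp f j + cm F' j * cm f j = cp f' j * cp g j + cm f' j * cm g j" for j
      using A S_graph_coeffs[OF f', of j] by (simp add: algebra_simps)
  qed (use A in auto)
  then show "(f, g) \<in> S_graph G" by (subst S_graph_adjoint) (use A in auto)
qed

text \<open>Each link of the chain multiplies the coefficients by the eigenvalues once more.\<close>

lemma Wpos_powers:
  assumes "f \<in> Wpos G m" "k \<le> m"
  obtains g where "g \<in> V0 G" "\<And>j. cp g j = lam j ^ k * cp f j" "\<And>j. cm g j = (- lam j) ^ k * cm f j"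
proof -
  obtain F where F: "F 0 = f" "f \<in> V0 G" "\<forall>k<m. (F k, F (Suc k)) \<in> S_graph G"
    using assms(1) unfolding Wpos_iff_S_graph by blast
  have "F k \<in> V0 G \<and> (\<forall>j. cp (F k) j = lam j ^ k * cp f j \<and> cm (F k) j = (- lam j) ^ k * cm f j)"
    using assms(2)
  proof (induction k)
    case 0
    then show ?case using F by simp
  next
    case (Suc k)
    then have "(F k, F (Suc k)) \<in> S_graph G" using F(3) by simp
    then show ?case using Suc unfolding S_graph_iff by simp
  qed
  then show ?thesis using that by blast
qed

lemma Wpos_V0: "f \<in> Wpos G m \<Longrightarrow> f \<in> V0 G"
  by (auto simp: Wpos_def)

text \<open>Riesz-Fischer supplies every member of the chain from its intended coefficients, and
  \<open>S_graph_iff\<close> links neighbours. Summability at the lower orders k follows from that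
  at order m because the eigenvalues are at least \<open>lam 0\<close>.\<close>

lemma Wpos_if_summable:
  assumes f: "f \<in> V0 G" and sum: "summable (\<lambda>j. lam j ^ (2 * m) * ((cp f j)\<^sup>2 + (cm f j)\<^sup>2))"
  shows "f \<in> Wpos G m"
proof -
  have ex: "\<exists>g. g \<in> V0 G \<and>
      (\<forall>j. cp g j = lam j ^ k * cp f j \<and> cm g j = (- lam j) ^ k * cm f j)" if k: "k \<le> m" for k
  proof -
    have "summable (\<lambda>j. (lam j ^ k * cp f j)\<^sup>2 + ((- lam j) ^ k * cm f j)\<^sup>2)"
    proof (rule summable_comparison_test')
      \<comment> \<open>The constant bounds the missing factor: \<open>lam j ^ (2 * k)\<close> is
        \<open>lam j ^ (2 * m)\<close> divided by \<open>lam j ^ (2 * (m - k))\<close>, which is at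
        least \<open>lam 0 ^ (2 * (m - k))\<close>.\<close>
      show "summable (\<lambda>j. inverse (lam 0 ^ (2 * (m - k))) *
          (lam j ^ (2 * m) * ((cp f j)\<^sup>2 + (cm f j)\<^sup>2)))"
        by (rule summable_mult[OF sum])
      fix j :: nat
      define c where "c = (cp f j)\<^sup>2 + (cm f j)\<^sup>2"
      have c: "0 \<le> c" by (simp add: c_def)
      have sq: "((- lam j) ^ k)\<^sup>2 = lam j ^ (2 * k)" "(lam j ^ k)\<^sup>2 = lam j ^ (2 * k)"
        by (simp_all add: mult.commute flip: power_mult)
      have "lam 0 ^ (2 * (m - k)) * lam j ^ (2 * k) \<le> lam j ^ (2 * (m - k)) * lam j ^ (2 * k)"
        using lam_pos lam_mono by (intro mult_right_mono power_mono) (auto simp: less_imp_le monoD)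
      also have "\<dots> = lam j ^ (2 * m)" using k by (simp add: diff_mult_distrib2 flip: power_add)
      finally have "lam j ^ (2 * k) \<le> inverse (lam 0 ^ (2 * (m - k))) * lam j ^ (2 * m)"
        using lam_pos[of 0] by (simp add: field_simps)
      then have "lam j ^ (2 * k) * c \<le> inverse (lam 0 ^ (2 * (m - k))) * lam j ^ (2 * m) * c"
        using c by (rule mult_right_mono)
      then have "(lam j ^ k * cp f j)\<^sup>2 + ((- lam j) ^ k * cm f j)\<^sup>2
          \<le> inverse (lam 0 ^ (2 * (m - k))) * (lam j ^ (2 * m) * ((cp f j)\<^sup>2 + (cm f j)\<^sup>2))"
        unfolding power_mult_distrib sq by (simp only: c_def distrib_left mult.assoc)
      then show "norm ((lam j ^ k * cp f j)\<^sup>2 + ((- lam j) ^ k * cm f j)\<^sup>2)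
          \<le> inverse (lam 0 ^ (2 * (m - k))) * (lam j ^ (2 * m) * ((cp f j)\<^sup>2 + (cm f j)\<^sup>2))"
        unfolding real_norm_def abs_of_nonneg[OF sum_power2_ge_zero] .
    qed
    from riesz_fischer[OF this] show ?thesis by blast
  qed
  obtain F where F: "\<And>k. k \<le> m \<Longrightarrow> F k \<in> V0 G \<and>
      (\<forall>j. cp (F k) j = lam j ^ k * cp f j \<and> cm (F k) j = (- lam j) ^ k * cm f j)"
    using ex by metis
  \<comment> \<open>\<open>F 0\<close> has the coefficients of f but may differ from f on a null
    set, whereas the chain must start with f itself.\<close>
  define F' where "F' = F(0 := f)"
  have F': "F' k \<in> V0 G \<and>
      (\<forall>j. cp (F' k) j = lam j ^ k * cp f j \<and> cm (F' k) j = (- lam j) ^ k * cm f j)" if "k \<le> m" for k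
    using F[OF that] f by (cases k) (simp_all add: F'_def)
  have "(F' k, F' (Suc k)) \<in> S_graph G" if "k < m" for k
    using F'[of k] F'[of "Suc k"] that by (simp add: S_graph_iff)
  then show ?thesis
    unfolding Wpos_iff_S_graph using f by (intro exI[of _ F']) (simp add: F'_def)
qed

text \<open>\<open>S_op\<close> chooses a representative at each application, but membership in the
  graph depends on coefficients only. Hence a field from \<open>Wpos_powers\<close> witnesses that
  the next choice is possible.\<close>

lemma S_op_power:
  assumes "f \<in> Wpos G m" "k \<le> m"
  shows "(S_op G ^^ k) f \<in> V0 G \<and>
    (\<forall>j. cp ((S_op G ^^ k) f) j = lam j ^ k * cp f j \<and> cm ((S_op G ^^ k) f) j = (- lam j) ^ k * cm f j)"
  using assms(2)
proof (induction k)
  case 0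
  then show ?case using Wpos_V0[OF assms(1)] by simp
next
  case (Suc k)
  let ?g = "(S_op G ^^ k) f"
  obtain h where "h \<in> V0 G" "\<And>j. cp h j = lam j ^ Suc k * cp f j" "\<And>j. cm h j = (- lam j) ^ Suc k * cm f j"
    using Wpos_powers[OF assms(1) Suc.prems] by blast
  then have "(?g, h) \<in> S_graph G" using Suc by (simp add: S_graph_iff)
  then have "(?g, S_op G ?g) \<in> S_graph G"
    unfolding S_op_def[of G ?g] by (rule someI[of "\<lambda>F. (?g, F) \<in> S_graph G"])
  then show ?case using Suc by (simp add: S_graph_iff)
qed

text \<open>The choice in \<open>Spow_field\<close> is controlled only once some field has the
  prescribed coefficients; w is that witness.\<close>

lemma Spow_field_if_coeffs:
  assumes "w \<in> V0 G" "\<And>j. cp w j = lam j powi p * v (qp j)" "\<And>j. cm w j = (- lam j) powi p * v (qm j)"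
  shows "Spow_field G lam qp qm p v \<in> V0 G"
    and "cp (Spow_field G lam qp qm p v) j = cp w j"
    and "cm (Spow_field G lam qp qm p v) j = cm w j"
proof -
  let ?P = "\<lambda>w. w \<in> V0 G \<and> (\<forall>j. ip G w (qp j) = lam j powi p * v (qp j) \<and>
      ip G w (qm j) = (- lam j) powi p * v (qm j))"
  have "?P w" using assms by simp
  then have "?P (Spow_field G lam qp qm p v)" unfolding Spow_field_def by (rule someI[of ?P])
  then show "Spow_field G lam qp qm p v \<in> V0 G"
    "cp (Spow_field G lam qp qm p v) j = cp w j"
    "cm (Spow_field G lam qp qm p v) j = cm w j"
    using assms by simp_all
qed

text \<open>Functionals are specified only on \<open>func_dom\<close>, so reading off coefficients
  requires the eigenfields to lie there. They have a single nonzero coefficient, which makes every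
  weighted series finite, and their part in \<open>BH G\<close> is zero.\<close>

lemma q_func_dom: "qp j \<in> func_dom G m" "qm j \<in> func_dom G m"
proof -
  have "qp j \<in> Wpos G m" "qm j \<in> Wpos G m"
    by (rule Wpos_if_summable, rule qp_V0 qm_V0,
        rule summable_finite[of "{j}"], simp, simp add: q_orthonormal)+
  then show "qp j \<in> func_dom G m" "qm j \<in> func_dom G m"
    unfolding func_dom_def using BH_zero by (force simp: fun_eq_iff)+
qed

lemma BH_func_dom:
  assumes "h \<in> BH G"
  shows "h \<in> func_dom G m"
proof -
  have "(\<lambda>x. 0) \<in> Wpos G m"
    by (rule Wpos_if_summable) (simp_all add: V0_zero ip_zero_left)
  then show ?thesis
    unfolding func_dom_def using assms by (force simp: fun_eq_iff)
qed

text \<open>Orthonormality leaves one term of the series, so a functional returns the coefficients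
  it was built from and powers of S can be composed.\<close>

lemma func_of_coeffs_eigenfield:
  "func_of_coeffs G qp qm m a b (qp j) = a j"
  "func_of_coeffs G qp qm m a b (qm j) = b j"
  using sums_unique[OF sums_single[of j a]] sums_unique[OF sums_single[of j b]]
  by (simp_all add: func_of_coeffs_def q_func_dom q_orthonormal if_distrib[of "(*) _"] eq_commute[of j]
      cong: if_cong)

lemma func_of_coeffs_BH:
  assumes "h \<in> BH G"
  shows "func_of_coeffs G qp qm m a b h = 0"
proof -
  have "cp h j = 0" "cm h j = 0" for j
    using assms qp_V0[of j] qm_V0[of j] by (simp_all add: V0_def ip_commute[of G h])
  then show ?thesis using BH_func_dom[OF assms] by (simp add: func_of_coeffs_def)
qed

section \<open>The maps S^(2m) and S^(-2m) between \<open>Wpos\<close> and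
  \<open>Wneg\<close>\<close>

lemma powi_nat:
  fixes x :: real
  shows "x powi (2 * int m) = x ^ (2 * m)" "x powi (- 2 * int m) = inverse (x ^ (2 * m))"
    "x powi (- int m) = inverse (x ^ m)"
proof -
  show "x powi (2 * int m) = x ^ (2 * m)"
    using power_int_of_nat[of x "2 * m"] by simp
  then show "x powi (- 2 * int m) = inverse (x ^ (2 * m))"
    using power_int_minus[of x "2 * int m"] by simp
  show "x powi (- int m) = inverse (x ^ m)"
    by (simp add: power_int_minus)
qed

text \<open>The even exponent removes the sign of the negative eigenvalues.\<close>

lemma Spow_func_coeffs:
  "Spow_func G lam qp qm m (2 * int m) v (qp j) = lam j ^ (2 * m) * v (qp j)"
  "Spow_func G lam qp qm m (2 * int m) v (qm j) = lam j ^ (2 * m) * v (qm j)"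
  by (simp_all add: Spow_func_def func_of_coeffs_eigenfield powi_nat)

text \<open>The weight lam^(-2m) against the square of lam^(2m) leaves lam^(2m), so the series in
  question is that of the squared coefficients of S^m u.\<close>

lemma Spow_func_Wneg:
  assumes u: "u \<in> Wpos G m"
  shows "Spow_func G lam qp qm m (2 * int m) (ip G u) \<in> Wneg G lam qp qm m"
proof -
  let ?v = "Spow_func G lam qp qm m (2 * int m) (ip G u)"
  obtain g where g: "g \<in> V0 G" "\<And>j. cp g j = lam j ^ m * cp u j" "\<And>j. cm g j = (- lam j) ^ m * cm u j"
    using Wpos_powers[OF u order_refl] by blast
  have "lam j powi (- 2 * int m) * ((?v (qp j))\<^sup>2 + (?v (qm j))\<^sup>2) = (cp g j)\<^sup>2 + (cm g j)\<^sup>2" for j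
  proof -
    have "((- lam j) ^ m)\<^sup>2 = lam j ^ (2 * m)" "(lam j ^ m)\<^sup>2 = lam j ^ (2 * m)"
      by (simp_all add: mult.commute flip: power_mult)
    then show ?thesis
      by (simp only: powi_nat Spow_func_coeffs g power_mult_distrib)
        (simp add: power2_eq_square field_simps)
  qed
  then have "summable (\<lambda>j. lam j powi (- 2 * int m) * ((?v (qp j))\<^sup>2 + (?v (qm j))\<^sup>2))"
    using coeffs_summable[OF g(1)] by simp
  moreover have "?v = func_of_coeffs G qp qm m (\<lambda>j. ?v (qp j)) (\<lambda>j. ?v (qm j))"
    by (simp add: Spow_func_def func_of_coeffs_eigenfield)
  moreover have "\<forall>h\<in>BH G. ?v h = 0"
    by (simp add: Spow_func_def func_of_coeffs_BH)
  ultimately show ?thesis unfolding Wneg_def by blast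
qed

text \<open>u itself witnesses the choice. Fields are determined by coefficients only almost
  everywhere, hence \<open>eq_ae\<close>.\<close>

lemma Spow_field_Spow_func:
  assumes u: "u \<in> Wpos G m"
  shows "eq_ae G (Spow_field G lam qp qm (- 2 * int m)
    (Spow_func G lam qp qm m (2 * int m) (ip G u))) u"
proof -
  let ?v = "Spow_func G lam qp qm m (2 * int m) (ip G u)"
  have "cp u j = lam j powi (- 2 * int m) * ?v (qp j)"
    "cm u j = (- lam j) powi (- 2 * int m) * ?v (qm j)" for j
    unfolding powi_nat Spow_func_coeffs by simp_all
  note w = Spow_field_if_coeffs[OF Wpos_V0[OF u], of _ ?v, OF this]
  show ?thesis by (rule eq_ae_if_coeffs_eq[OF w(1) Wpos_V0[OF u] w(2,3)])
qed

text \<open>The squared coefficients carry lam^(-4m), which the lower bound on the eigenvalues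
  controls by the given weight lam^(-2m); Riesz-Fischer then yields a field. Membership in
  \<open>Wpos G m\<close> adds the weight lam^(2m), which reproduces the given series
  exactly.\<close>

lemma Spow_field_Wneg:
  assumes v: "v \<in> Wneg G lam qp qm m"
  defines "w \<equiv> Spow_field G lam qp qm (- 2 * int m) v"
  shows "w \<in> Wpos G m"
    and "cp w j = inverse (lam j ^ (2 * m)) * v (qp j)"
    and "cm w j = inverse (lam j ^ (2 * m)) * v (qm j)"
proof -
  have sum: "summable (\<lambda>j. lam j powi (- 2 * int m) * ((v (qp j))\<^sup>2 + (v (qm j))\<^sup>2))"
    using v by (simp add: Wneg_def)
  have "summable (\<lambda>j. (inverse (lam j ^ (2 * m)) * v (qp j))\<^sup>2 + (inverse (lam j ^ (2 * m)) * v (qm j))\<^sup>2)"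
  proof (rule summable_comparison_test')
    \<comment> \<open>One factor lam^(-2m) is estimated by its value at the smallest eigenvalue
      \<open>lam 0\<close>; the other is the weight in \<open>Wneg\<close>.\<close>
    show "summable (\<lambda>j. inverse (lam 0 ^ (2 * m)) *
        (lam j powi (- 2 * int m) * ((v (qp j))\<^sup>2 + (v (qm j))\<^sup>2)))"
      by (rule summable_mult[OF sum])
    fix j :: nat
    define c where "c = inverse (lam j ^ (2 * m)) * ((v (qp j))\<^sup>2 + (v (qm j))\<^sup>2)"
    have "inverse (lam j ^ (2 * m)) \<le> inverse (lam 0 ^ (2 * m))"
      using lam_pos lam_mono by (intro le_imp_inverse_le power_mono) (auto simp: less_imp_le monoD)
    moreover have "0 \<le> c" unfolding c_def using lam_pos[of j] by simp
    ultimately have "inverse (lam j ^ (2 * m)) * c \<le> inverse (lam 0 ^ (2 * m)) * c"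
      by (rule mult_right_mono)
    then have "(inverse (lam j ^ (2 * m)) * v (qp j))\<^sup>2 + (inverse (lam j ^ (2 * m)) * v (qm j))\<^sup>2
        \<le> inverse (lam 0 ^ (2 * m)) * (lam j powi (- 2 * int m) * ((v (qp j))\<^sup>2 + (v (qm j))\<^sup>2))"
      unfolding powi_nat power_mult_distrib
      by (simp only: c_def distrib_left mult.assoc power2_eq_square)
    then show "norm ((inverse (lam j ^ (2 * m)) * v (qp j))\<^sup>2 + (inverse (lam j ^ (2 * m)) * v (qm j))\<^sup>2)
        \<le> inverse (lam 0 ^ (2 * m)) * (lam j powi (- 2 * int m) * ((v (qp j))\<^sup>2 + (v (qm j))\<^sup>2))"
      unfolding real_norm_def abs_of_nonneg[OF sum_power2_ge_zero] .
  qed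
  from riesz_fischer[OF this] obtain w' where w': "w' \<in> V0 G" "\<And>j. cp w' j = inverse (lam j ^ (2 * m)) * v (qp j)"
    "\<And>j. cm w' j = inverse (lam j ^ (2 * m)) * v (qm j)"
    by blast
  have "cp w' j = lam j powi (- 2 * int m) * v (qp j)"
    "cm w' j = (- lam j) powi (- 2 * int m) * v (qm j)" for j
    unfolding powi_nat w' by simp_all
  note w = Spow_field_if_coeffs[OF w'(1), of _ v, OF this, folded w_def, unfolded w']
  then show "cp w j = inverse (lam j ^ (2 * m)) * v (qp j)"
    "cm w j = inverse (lam j ^ (2 * m)) * v (qm j)"
    by simp_all
  have "lam j ^ (2 * m) * ((cp w j)\<^sup>2 + (cm w j)\<^sup>2)
      = lam j powi (- 2 * int m) * ((v (qp j))\<^sup>2 + (v (qm j))\<^sup>2)" for j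
    unfolding powi_nat w by (simp add: power2_eq_square field_simps)
  then show "w \<in> Wpos G m" using sum by (intro Wpos_if_summable w(1)) simp
qed

text \<open>Here the equality is literal: by definition an element of \<open>Wneg\<close> is the
  functional built from its own coefficients.\<close>

lemma Spow_func_Spow_field:
  assumes v: "v \<in> Wneg G lam qp qm m"
  shows "Spow_func G lam qp qm m (2 * int m) (ip G (Spow_field G lam qp qm (- 2 * int m) v)) = v"
proof -
  have "lam j ^ (2 * m) * (inverse (lam j ^ (2 * m)) * c) = c"
    "(- lam j) ^ (2 * m) * (inverse (lam j ^ (2 * m)) * c) = c" for j and c :: real
    by (simp_all flip: mult.assoc)
  then have "Spow_func G lam qp qm m (2 * int m) (ip G (Spow_field G lam qp qm (- 2 * int m) v))
      = func_of_coeffs G qp qm m (\<lambda>j. v (qp j)) (\<lambda>j. v (qm j))"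
    unfolding Spow_func_def Spow_field_Wneg(2,3)[OF v] powi_nat by (simp only:)
  also have "\<dots> = v" using v by (simp add: Wneg_def)
  finally show ?thesis .
qed

text \<open>The iterate of \<open>S_op\<close>, w and z all have the coefficients of one field g
  representing S^m u, so Parseval gives them the same norm.\<close>

lemma isometry:
  assumes u: "u \<in> Wpos G m"
  defines "v \<equiv> Spow_func G lam qp qm m (2 * int m) (ip G u)"
  defines "w \<equiv> Spow_field G lam qp qm (int m) (ip G u)"
    and "z \<equiv> Spow_field G lam qp qm (- int m) v"
  shows "ip_pos G m u u = ip G w w" and "ip G w w = ip G z z"
proof -
  obtain g where g: "g \<in> V0 G" "\<And>j. cp g j = lam j ^ m * cp u j" "\<And>j. cm g j = (- lam j) ^ m * cm u j"
    using Wpos_powers[OF u order_refl] by blast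
  have "cp g j = lam j powi int m * cp u j" "cm g j = (- lam j) powi int m * cm u j" for j
    by (simp_all add: g)
  note w = Spow_field_if_coeffs[OF g(1), of _ "ip G u", OF this, folded w_def]
  have "cp g j = lam j powi (- int m) * v (qp j)"
    "cm g j = (- lam j) powi (- int m) * v (qm j)" for j
  proof -
    \<comment> \<open>For the negative eigenvalues this is used with x = \<open>- lam j\<close>,
      whose power of order 2m equals that of \<open>lam j\<close>.\<close>
    have pow: "x ^ m * c = inverse (x ^ m) * (x ^ (2 * m) * c)" if "x \<noteq> 0" for x c :: real
      using that by (simp add: mult_2 power_add)
    show "cp g j = lam j powi (- int m) * v (qp j)"
      unfolding v_def Spow_func_coeffs powi_nat g by (rule pow) simp
    show "cm g j = (- lam j) powi (- int m) * v (qm j)"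
      unfolding v_def Spow_func_coeffs powi_nat g using pow[of "- lam j" "cm u j"] by simp
  qed
  note z = Spow_field_if_coeffs[OF g(1), of _ v, OF this, folded z_def]
  show "ip G w w = ip G z z"
    by (rule ip_eq_if_coeffs_eq) (simp_all add: w z)
  show "ip_pos G m u u = ip G w w"
    unfolding ip_pos_def using S_op_power[OF u order_refl]
    by (intro ip_eq_if_coeffs_eq) (simp_all add: w g)
qed

end

theorem mainTheorem4:
  fixes G :: "(real^3) set" and lam :: "nat \<Rightarrow> real" and qp qm :: "nat \<Rightarrow> field" and m :: nat
  assumes "smooth_bounded_domain G"
    and "self_adjoint_in G (V0 G) (S_graph G)"
    and "\<forall>j. 0 < lam j" and "mono lam"
    and "orthonormal_basis G (V0 G) qp qm"
    and "\<forall>j. smooth_upto_boundary G (qp j) \<and> smooth_upto_boundary G (qm j)"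
    and "\<forall>j. has_rot G (qp j) (\<lambda>x. lam j *\<^sub>R qp j x) \<and> has_rot G (qm j) (\<lambda>x. - lam j *\<^sub>R qm j x)"
    and "\<forall>j. normal_component_zero G (qp j) \<and> normal_component_zero G (qm j)"
    and "m \<ge> 1"
  shows
    "(\<forall>u\<in>Wpos G m.
        Spow_func G lam qp qm m (2 * int m) (ip G u) \<in> Wneg G lam qp qm m \<and>
        eq_ae G (Spow_field G lam qp qm (- 2 * int m)
                  (Spow_func G lam qp qm m (2 * int m) (ip G u))) u) \<and>
     (\<forall>v\<in>Wneg G lam qp qm m.
        Spow_field G lam qp qm (- 2 * int m) v \<in> Wpos G m \<and>
        Spow_func G lam qp qm m (2 * int m)
          (ip G (Spow_field G lam qp qm (- 2 * int m) v)) = v) \<and>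
     (\<forall>u\<in>Wpos G m. \<forall>v. v = Spow_func G lam qp qm m (2 * int m) (ip G u) \<longrightarrow>
        ip_pos G m u u =
          ip G (Spow_field G lam qp qm (int m) (ip G u)) (Spow_field G lam qp qm (int m) (ip G u)) \<and>
        ip G (Spow_field G lam qp qm (int m) (ip G u)) (Spow_field G lam qp qm (int m) (ip G u)) =
          ip G (Spow_field G lam qp qm (- int m) v) (Spow_field G lam qp qm (- int m) v) \<and>
        ip G (Spow_field G lam qp qm (- int m) v) (Spow_field G lam qp qm (- int m) v) =
          ip_neg G lam qp qm m v v)"
proof -
  interpret rot_eigenbasis G lam qp qm
    using assms(2-5,7) by unfold_locales auto
  show ?thesis
    \<comment> \<open>The last equality of the chain is the definition of
      \<open>ip_neg\<close>.\<close>
    using Spow_func_Wneg Spow_field_Spow_func Spow_field_Wneg(1) Spow_func_Spow_field isometry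
    unfolding ip_neg_def by blast
qed

end
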